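(* For all $g,h\in G_{\mathrm{nff}}$ such that $g*h$ is defined, $$[[\pi(g),\,\pi(g*h),\,\pi(h)]]=0,$$ where $G_{\mathrm{nff}}$, its partial operation $*$, and the map $\pi$ are as defined in the context.
   Context: Let $V=\mathbb{C}^2$ with standard basis $e_1,e_2$. For $u,w,v\in\mathrm{End}(V\otimes V)$ set $[[u,w,v]]=(u\otimes 1)(1\otimes w)(v\otimes 1)-(1\otimes v)(w\otimes 1)(1\otimes u)$, an operator on $V\otimes V\otimes V$. A six-vertex matrix is an invertible complex $4\times4$ matrix $$u=\begin{pmatrix} a_1(u)&0&0&0\\0&c_1(u)&b_1(u)&0\\0&b_2(u)&c_2(u)&0\\0&0&0&a_2(u)\end{pmatrix},$$ viewed as an operator on $V\otimes V$ in the ordered basis $e_1\otimes e_1, e_1\otimes e_2, e_2\otimes e_1, e_2\otimes e_2$. Let $S$ be the set of six-vertex matrices with $c_1,c_2\neq0$, and let $S^\times\subset S$ be the set of those with also $b_1,b_2\ne0$ (so $a_1,a_2,b_1,b_2,c_1,c_2$ are all nonzero). For $u\in S^\times$ put $$\Delta_1(u)=\frac{a_1(u)a_2(u)+b_1(u)b_2(u)-c_1(u)c_2(u)}{2a_1(u)b_1(u)},\qquad \Delta_2(u)=\frac{a_1(u)a_2(u)+b_1(u)b_2(u)-c_1(u)c_2(u)}{2a_2(u)b_2(u)},$$ and $\Delta(u)=(\Delta_1(u),\Delta_2(u))$. These are invariant under rescaling $u$ by a nonzero scalar. Let $S_{\mathrm{nff}}=\{u\in S^\times:\Delta(u)\neq(0,0)\}$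 (non-free-fermionic matrices); for such $u$ both $\Delta_1(u),\Delta_2(u)$ are nonzero. Matrices are considered up to nonzero scalar. Yang-Baxter composition: for $u,v\in S^\times$, $u*v$ denotes the class, up to nonzero scalar, of a matrix $w\in S^\times$ with $[[u,w,v]]=0$, whenever such a $w$ exists (it is then unique up to nonzero scalar). The set $G_{\mathrm{nff}}$ (the non-free-fermionic groupoid) consists of the pairs $(u,\Delta(u))$ with $u\in S_{\mathrm{nff}}$ (taken up to nonzero scalar) together with the identities $(I,(\delta_1,\delta_2))$ for all $(\delta_1,\delta_2)\in(\mathbb{C}^\times)^2$, where $I$ is the $4\times4$ identity matrix. The unary operation is $(u,\Delta(u))^{-1}=(u^{-1},\Delta(u^{-1}))$ with $u^{-1}$ the matrix inverse, and $(I,\delta)^{-1}=(I,\delta)$. The partial binary operation is: (i) $(u,\Delta(u))*(v,\Delta(v))=(u*v,\Delta(u*v))$, defined only when $\Delta(u)=\Delta(v^{-1})$ and the Yang-Baxter composition $u*v$ exists; (ii) $(u,\Delta(u))*(u^{-1},\Delta(u^{-1}))=(I,\Delta(u^{-1}))$; (iii) $(I,\Delta(v^{-1}))*(v,\Delta(v))=(v,\Delta(v))$, $(u,\Delta(u))*(I,\Delta(u))=(u,\Delta(u))$, and $(I,\delta)*(I,\delta)=(I,\delta)$. No other products are defined. The map $\pi$ from $G_{\mathrm{nff}}$ to six-vertex matrices is $\pi(u,\Delta(u))=u$ (any chosen representative of the class up to scalar) and $\pi(I,(\delta_1,\delta_2))=I$. *)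

theory Defs
  imports "HOL-Analysis.Analysis"
begin

text \<open>Operators on \<open>V \<otimes> V\<close> and \<open>V \<otimes> V \<otimes> V\<close>, for \<open>V = \<complex>\<^sup>2\<close>, are represented by their matrices in the
  tensor product basis: the index \<open>(i, j)\<close> stands for \<open>e\<^sub>i \<otimes> e\<^sub>j\<close>, and \<open>A $ p $ q\<close> is the
  entry in row \<open>p\<close> and column \<open>q\<close>.\<close>

type_synonym op2 = "complex^(2 \<times> 2)^(2 \<times> 2)"
type_synonym op3 = "complex^(2 \<times> 2 \<times> 2)^(2 \<times> 2 \<times> 2)"

definition op_left :: "op2 \<Rightarrow> op3" where \<comment> \<open>\<open>u \<otimes> 1\<close>\<close>
  "op_left u = (\<chi> p q. case (p, q) of ((i, j, k), (i', j', k')) \<Rightarrow>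
     u $ (i, j) $ (i', j') * mat 1 $ k $ k')"

definition op_right :: "op2 \<Rightarrow> op3" where \<comment> \<open>\<open>1 \<otimes> u\<close>\<close>
  "op_right u = (\<chi> p q. case (p, q) of ((i, j, k), (i', j', k')) \<Rightarrow>
     mat 1 $ i $ i' * u $ (j, k) $ (j', k'))"

definition yb_bracket :: "op2 \<Rightarrow> op2 \<Rightarrow> op2 \<Rightarrow> op3" where
  "yb_bracket u w v =
     op_left u ** op_right w ** op_left v - op_right v ** op_left w ** op_right u"

text \<open>The entries named as in
  \<open>(a\<^sub>1 0 0 0 | 0 c\<^sub>1 b\<^sub>1 0 | 0 b\<^sub>2 c\<^sub>2 0 | 0 0 0 a\<^sub>2)\<close> (rows separated by bars), in the ordered basis
  \<open>e\<^sub>1 \<otimes> e\<^sub>1, e\<^sub>1 \<otimes> e\<^sub>2, e\<^sub>2 \<otimes> e\<^sub>1, e\<^sub>2 \<otimes> e\<^sub>2\<close>.\<close>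

definition wt_a1 :: "op2 \<Rightarrow> complex" where "wt_a1 u = u $ (1, 1) $ (1, 1)"
definition wt_a2 :: "op2 \<Rightarrow> complex" where "wt_a2 u = u $ (2, 2) $ (2, 2)"
definition wt_b1 :: "op2 \<Rightarrow> complex" where "wt_b1 u = u $ (1, 2) $ (2, 1)"
definition wt_b2 :: "op2 \<Rightarrow> complex" where "wt_b2 u = u $ (2, 1) $ (1, 2)"
definition wt_c1 :: "op2 \<Rightarrow> complex" where "wt_c1 u = u $ (1, 2) $ (1, 2)"
definition wt_c2 :: "op2 \<Rightarrow> complex" where "wt_c2 u = u $ (2, 1) $ (2, 1)"

definition six_vertex :: "op2 set" where
  "six_vertex = {u. invertible u \<and>
     (\<forall>p q. (p, q) \<notin> {((1, 1), (1, 1)), ((2, 2), (2, 2)),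
                      ((1, 2), (1, 2)), ((1, 2), (2, 1)),
                      ((2, 1), (1, 2)), ((2, 1), (2, 1))} \<longrightarrow> u $ p $ q = 0)}"

definition sv_S :: "op2 set" where
  "sv_S = {u \<in> six_vertex. wt_c1 u \<noteq> 0 \<and> wt_c2 u \<noteq> 0}"

definition sv_Sx :: "op2 set" where
  "sv_Sx = {u \<in> sv_S. wt_b1 u \<noteq> 0 \<and> wt_b2 u \<noteq> 0}"

definition Delta1 :: "op2 \<Rightarrow> complex" where
  "Delta1 u = (wt_a1 u * wt_a2 u + wt_b1 u * wt_b2 u - wt_c1 u * wt_c2 u) / (2 * wt_a1 u * wt_b1 u)"

definition Delta2 :: "op2 \<Rightarrow> complex" where
  "Delta2 u = (wt_a1 u * wt_a2 u + wt_b1 u * wt_b2 u - wt_c1 u * wt_c2 u) / (2 * wt_a2 u * wt_b2 u)"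

definition Delta :: "op2 \<Rightarrow> complex \<times> complex" where
  "Delta u = (Delta1 u, Delta2 u)"

definition sv_nff :: "op2 set" where
  "sv_nff = {u \<in> sv_Sx. Delta u \<noteq> (0, 0)}"

definition op_scale :: "complex \<Rightarrow> op2 \<Rightarrow> op2" where
  "op_scale t u = (\<chi> p q. t * u $ p $ q)"

definition scalar_class :: "op2 \<Rightarrow> op2 set" where
  "scalar_class u = {op_scale t u | t. t \<noteq> 0}"

definition is_yb_comp :: "op2 \<Rightarrow> op2 \<Rightarrow> op2 \<Rightarrow> bool" where
  "is_yb_comp u v w \<longleftrightarrow> w \<in> sv_Sx \<and> yb_bracket u w v = 0"

text \<open>Elements of the groupoid are pairs \<open>(class up to nonzero scalar, \<delta>)\<close>.\<close>

type_synonym gpd = "op2 set \<times> (complex \<times> complex)"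

definition nff_elt :: "op2 \<Rightarrow> gpd" where
  "nff_elt u = (scalar_class u, Delta u)"

definition nff_id :: "complex \<times> complex \<Rightarrow> gpd" where
  "nff_id \<delta> = (scalar_class (mat 1), \<delta>)"

definition G_nff :: "gpd set" where
  "G_nff = nff_elt ` sv_nff \<union> nff_id ` ((UNIV - {0}) \<times> (UNIV - {0}))"

text \<open>\<open>nff_prod g h k\<close> is the graph \<open>g * h = k\<close> of the partial binary operation. Since \<open>nff_elt\<close> is
  constant on scalar classes, the rules may be read with any representatives.\<close>

inductive nff_prod :: "gpd \<Rightarrow> gpd \<Rightarrow> gpd \<Rightarrow> bool" where
  comp: "\<lbrakk>u \<in> sv_nff; v \<in> sv_nff; Delta u = Delta (matrix_inv v); is_yb_comp u v w\<rbrakk>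
    \<Longrightarrow> nff_prod (nff_elt u) (nff_elt v) (nff_elt w)"
| inv: "u \<in> sv_nff
    \<Longrightarrow> nff_prod (nff_elt u) (nff_elt (matrix_inv u)) (nff_id (Delta (matrix_inv u)))"
| id_left: "v \<in> sv_nff
    \<Longrightarrow> nff_prod (nff_id (Delta (matrix_inv v))) (nff_elt v) (nff_elt v)"
| id_right: "u \<in> sv_nff
    \<Longrightarrow> nff_prod (nff_elt u) (nff_id (Delta u)) (nff_elt u)"
| id_id: "\<delta> \<in> (UNIV - {0}) \<times> (UNIV - {0})
    \<Longrightarrow> nff_prod (nff_id \<delta>) (nff_id \<delta>) (nff_id \<delta>)"

definition nff_defined :: "gpd \<Rightarrow> gpd \<Rightarrow> bool" where
  "nff_defined g h \<longleftrightarrow> (\<exists>k. nff_prod g h k)"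

text \<open>The description operator is unproblematic: \<open>u * v\<close> is unique up to scalar, and the first two rules
  never apply to the same pair, because the solutions \<open>w\<close> of \<open>yb_bracket u w (matrix_inv u) = 0\<close>
  in \<open>six_vertex\<close>, for \<open>u \<in> sv_nff\<close>, have \<open>b\<^sub>1 w = 0\<close>. So \<open>nff_prod\<close> is right-unique.\<close>

definition nff_mult :: "gpd \<Rightarrow> gpd \<Rightarrow> gpd" where
  "nff_mult g h = (THE k. nff_prod g h k)"

text \<open>The maps that pick an arbitrary representative of the class of each non-identity element and
  send every identity to the identity matrix.\<close>

definition is_nff_proj :: "(gpd \<Rightarrow> op2) \<Rightarrow> bool" where
  "is_nff_proj \<pi> \<longleftrightarrow> (\<forall>g \<in> nff_elt ` sv_nff. \<pi> g \<in> fst g) \<and>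
     (\<forall>\<delta> \<in> (UNIV - {0}) \<times> (UNIV - {0}). \<pi> (nff_id \<delta>) = mat 1)"

end

theory Submission
  imports Defs
begin

text \<open>
  For the products with an identity the bracket vanishes by cancellation: \<open>[[1, v, v]]\<close>,
  \<open>[[u, u, 1]]\<close> and \<open>[[u, 1, u\<^sup>-\<^sup>1]]\<close> are zero because \<open>u \<mapsto> u \<otimes> 1\<close> and \<open>u \<mapsto> 1 \<otimes> u\<close> are unital algebra
  homomorphisms. For a genuine Yang--Baxter composition the bracket vanishes by definition, and the
  bracket is trilinear, so representatives of the scalar classes do not matter. What has to be
  proved is that \<open>\<pi> (g * h)\<close> is what this argument supposes it to be. There are two points.

  First, \<open>g * h\<close> must be determined by \<open>g\<close> and \<open>h\<close>. Five of the scalar equations contained in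
  \<open>[[u, w, v]] = 0\<close> are linear in \<open>w\<close> and can be solved one after the other; up to a scalar, \<open>w\<close> is
  the explicit matrix \<open>yb_solution u v\<close>. This makes the composition unique
  (\<open>yb_solution_unique\<close>). It also separates composition from inversion: if \<open>v\<close> is proportional to
  \<open>u\<^sup>-\<^sup>1\<close>, then the identity solves the equation, so every solution in \<open>S\<close> has \<open>b\<^sub>1 = 0\<close>, and a
  composition in \<open>S\<^sup>\<times>\<close> cannot exist.

  Second, \<open>\<pi>\<close> is constrained only on classes of non-free-fermionic matrices, so the composition
  \<open>w = u * v\<close> has to be non-free-fermionic. The explicit solution shows more:
  the condition \<open>\<Delta>(u) = \<Delta>(v\<^sup>-\<^sup>1)\<close> forces \<open>\<Delta>\<^sub>1(w) = \<Delta>\<^sub>1(v)\<close> (\<open>Delta1_yb_comp\<close>), and the right-hand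
  side is nonzero.
\<close>

section \<open>Six-vertex matrices\<close>

definition sv_mat :: "complex \<Rightarrow> complex \<Rightarrow> complex \<Rightarrow> complex \<Rightarrow> complex \<Rightarrow> complex \<Rightarrow> op2" where
  "sv_mat a1 a2 b1 b2 c1 c2 = (\<chi> p q.
     if p = (1, 1) \<and> q = (1, 1) then a1 else if p = (2, 2) \<and> q = (2, 2) then a2
     else if p = (1, 2) \<and> q = (2, 1) then b1 else if p = (2, 1) \<and> q = (1, 2) then b2
     else if p = (1, 2) \<and> q = (1, 2) then c1 else if p = (2, 1) \<and> q = (2, 1) then c2
     else 0)"

lemma wt_sv_mat [simp]:
  "wt_a1 (sv_mat a1 a2 b1 b2 c1 c2) = a1" "wt_a2 (sv_mat a1 a2 b1 b2 c1 c2) = a2"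
  "wt_b1 (sv_mat a1 a2 b1 b2 c1 c2) = b1" "wt_b2 (sv_mat a1 a2 b1 b2 c1 c2) = b2"
  "wt_c1 (sv_mat a1 a2 b1 b2 c1 c2) = c1" "wt_c2 (sv_mat a1 a2 b1 b2 c1 c2) = c2"
  by (simp_all add: sv_mat_def wt_a1_def wt_a2_def wt_b1_def wt_b2_def wt_c1_def wt_c2_def)

lemma six_vertex_eq_sv_mat:
  assumes "u \<in> six_vertex"
  shows "u = sv_mat (wt_a1 u) (wt_a2 u) (wt_b1 u) (wt_b2 u) (wt_c1 u) (wt_c2 u)"
  using assms
  by (auto simp: six_vertex_def sv_mat_def vec_eq_iff
      wt_a1_def wt_a2_def wt_b1_def wt_b2_def wt_c1_def wt_c2_def)

lemma sum_UNIV_prod: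
  fixes f :: "'a::finite \<times> 'b::finite \<Rightarrow> 'c::comm_monoid_add"
  shows "sum f UNIV = (\<Sum>i\<in>UNIV. \<Sum>j\<in>UNIV. f (i, j))"
  by (simp add: sum.cartesian_product)

lemma sv_mat_mult:
  "sv_mat a1 a2 b1 b2 c1 c2 ** sv_mat a1' a2' b1' b2' c1' c2' =
   sv_mat (a1 * a1') (a2 * a2') (c1 * b1' + b1 * c2') (b2 * c1' + c2 * b2')
     (c1 * c1' + b1 * b2') (b2 * b1' + c2 * c2')"
  by (simp add: vec_eq_iff forall_2 matrix_matrix_mult_def sum_UNIV_prod sum_2 sv_mat_def)

lemma mat_one_eq_sv_mat: "mat 1 = sv_mat 1 1 0 0 1 1"
  by (simp add: vec_eq_iff forall_2 mat_def sv_mat_def)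

lemma wt_op_scale [simp]:
  "wt_a1 (op_scale t u) = t * wt_a1 u" "wt_a2 (op_scale t u) = t * wt_a2 u"
  "wt_b1 (op_scale t u) = t * wt_b1 u" "wt_b2 (op_scale t u) = t * wt_b2 u"
  "wt_c1 (op_scale t u) = t * wt_c1 u" "wt_c2 (op_scale t u) = t * wt_c2 u"
  by (simp_all add: op_scale_def wt_a1_def wt_a2_def wt_b1_def wt_b2_def wt_c1_def wt_c2_def)

lemma op_scale_sv_mat:
  "op_scale t (sv_mat a1 a2 b1 b2 c1 c2) =
   sv_mat (t * a1) (t * a2) (t * b1) (t * b2) (t * c1) (t * c2)"
  by (simp add: vec_eq_iff op_scale_def sv_mat_def)

lemma op_scale_op_scale [simp]: "op_scale s (op_scale t u) = op_scale (s * t) u"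
  by (simp add: vec_eq_iff op_scale_def)

lemma op_scale_one [simp]: "op_scale 1 u = u"
  by (simp add: vec_eq_iff op_scale_def)

lemma sv_mat_inverse:
  assumes "a1 \<noteq> 0" "a2 \<noteq> 0" and D: "D = c1 * c2 - b1 * b2" "D \<noteq> 0"
  shows "sv_mat a1 a2 b1 b2 c1 c2 **
           sv_mat (1 / a1) (1 / a2) (- b1 / D) (- b2 / D) (c2 / D) (c1 / D) = mat 1"
    and "sv_mat (1 / a1) (1 / a2) (- b1 / D) (- b2 / D) (c2 / D) (c1 / D) **
           sv_mat a1 a2 b1 b2 c1 c2 = mat 1"
proof -
  have "(c1 * c2 - b1 * b2) / D = 1"
    using D by simp
  then have "c1 * c2 / D - b1 * b2 / D = 1"
    by (simp add: diff_divide_distrib)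
  then show "sv_mat a1 a2 b1 b2 c1 c2 **
      sv_mat (1 / a1) (1 / a2) (- b1 / D) (- b2 / D) (c2 / D) (c1 / D) = mat 1"
    and "sv_mat (1 / a1) (1 / a2) (- b1 / D) (- b2 / D) (c2 / D) (c1 / D) **
      sv_mat a1 a2 b1 b2 c1 c2 = mat 1"
    using assms(1,2) by (simp_all add: sv_mat_mult mat_one_eq_sv_mat algebra_simps)
qed

lemma invertible_sv_mat_iff:
  "invertible (sv_mat a1 a2 b1 b2 c1 c2) \<longleftrightarrow> a1 \<noteq> 0 \<and> a2 \<noteq> 0 \<and> c1 * c2 - b1 * b2 \<noteq> 0"
  (is "invertible ?u \<longleftrightarrow> ?nz")
proof
  assume "invertible ?u"
  then obtain x where x: "?u ** x = mat 1"
    by (auto simp: invertible_def)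
  have e: "(?u ** x) $ p $ q = (mat 1 :: op2) $ p $ q" for p q
    by (simp add: x)
  note d = matrix_matrix_mult_def sum_UNIV_prod sum_2 sv_mat_def mat_def
  have "a1 * x $ (1, 1) $ (1, 1) = 1" "a2 * x $ (2, 2) $ (2, 2) = 1"
    using e[of "(1, 1)" "(1, 1)"] e[of "(2, 2)" "(2, 2)"] by (simp_all add: d)
  moreover have
    "c1 * x $ (1, 2) $ (1, 2) + b1 * x $ (2, 1) $ (1, 2) = 1"
    "c1 * x $ (1, 2) $ (2, 1) + b1 * x $ (2, 1) $ (2, 1) = 0"
    "b2 * x $ (1, 2) $ (1, 2) + c2 * x $ (2, 1) $ (1, 2) = 0"
    "b2 * x $ (1, 2) $ (2, 1) + c2 * x $ (2, 1) $ (2, 1) = 1"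
    using e[of "(1, 2)" "(1, 2)"] e[of "(1, 2)" "(2, 1)"] e[of "(2, 1)" "(1, 2)"]
      e[of "(2, 1)" "(2, 1)"] by (simp_all add: d)
  \<comment> \<open>the determinant of the middle block is multiplicative\<close>
  then have "(c1 * c2 - b1 * b2) *
      (x $ (1, 2) $ (1, 2) * x $ (2, 1) $ (2, 1) - x $ (1, 2) $ (2, 1) * x $ (2, 1) $ (1, 2)) = 1"
    by algebra
  ultimately show ?nz
    by auto
next
  assume ?nz
  then show "invertible ?u"
    unfolding invertible_def using sv_mat_inverse[OF _ _ refl, of a1 a2 c1 c2 b1 b2] by metis
qed

lemma six_vertex_nonzero:
  assumes "u \<in> six_vertex"
  shows "wt_a1 u \<noteq> 0" "wt_a2 u \<noteq> 0" "wt_c1 u * wt_c2 u - wt_b1 u * wt_b2 u \<noteq> 0"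
proof -
  have "invertible (sv_mat (wt_a1 u) (wt_a2 u) (wt_b1 u) (wt_b2 u) (wt_c1 u) (wt_c2 u))"
    using assms unfolding six_vertex_eq_sv_mat[OF assms, symmetric] by (simp add: six_vertex_def)
  then show "wt_a1 u \<noteq> 0" "wt_a2 u \<noteq> 0" "wt_c1 u * wt_c2 u - wt_b1 u * wt_b2 u \<noteq> 0"
    by (simp_all add: invertible_sv_mat_iff)
qed

lemma sv_mat_in_six_vertex:
  assumes "a1 \<noteq> 0" "a2 \<noteq> 0" "c1 * c2 - b1 * b2 \<noteq> 0"
  shows "sv_mat a1 a2 b1 b2 c1 c2 \<in> six_vertex"
  unfolding six_vertex_def mem_Collect_eq invertible_sv_mat_iff
  using assms by (simp add: sv_mat_def)

lemma matrix_inv_unique: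
  fixes x :: "'a::semiring_1^'n^'n"
  assumes "u ** x = mat 1" "x ** u = mat 1"
  shows "matrix_inv u = x"
proof -
  have "u ** matrix_inv u = mat 1 \<and> matrix_inv u ** u = mat 1"
    unfolding matrix_inv_def by (rule someI[of _ x]) (simp add: assms)
  then have "x ** (u ** matrix_inv u) = x"
    by simp
  then show ?thesis
    by (simp add: matrix_mul_assoc assms)
qed

lemma matrix_inv_six_vertex:
  assumes "u \<in> six_vertex" and D: "D = wt_c1 u * wt_c2 u - wt_b1 u * wt_b2 u"
  shows "matrix_inv u = sv_mat (1 / wt_a1 u) (1 / wt_a2 u)
           (- wt_b1 u / D) (- wt_b2 u / D) (wt_c2 u / D) (wt_c1 u / D)" (is "_ = ?x")
    and "u ** matrix_inv u = mat 1" and "matrix_inv u ** u = mat 1"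
proof -
  note nz = six_vertex_nonzero[OF assms(1), folded D]
  have "u ** ?x = mat 1" "?x ** u = mat 1"
    using sv_mat_inverse[OF nz(1,2) D nz(3)]
    unfolding six_vertex_eq_sv_mat[OF assms(1), symmetric] by simp_all
  moreover from this show "matrix_inv u = ?x"
    by (rule matrix_inv_unique)
  ultimately show "u ** matrix_inv u = mat 1" "matrix_inv u ** u = mat 1"
    by simp_all
qed

section \<open>The free-fermion defect\<close>

text \<open>The common numerator of \<open>\<Delta>\<^sub>1\<close> and \<open>\<Delta>\<^sub>2\<close>; the free-fermionic matrices are those where it
  vanishes.\<close>

definition ff_defect :: "op2 \<Rightarrow> complex" where
  "ff_defect u = wt_a1 u * wt_a2 u + wt_b1 u * wt_b2 u - wt_c1 u * wt_c2 u"

lemma Delta_ff_defect: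
  "Delta1 u = ff_defect u / (2 * wt_a1 u * wt_b1 u)"
  "Delta2 u = ff_defect u / (2 * wt_a2 u * wt_b2 u)"
  by (simp_all add: Delta1_def Delta2_def ff_defect_def)

lemma sv_nff_iff: "u \<in> sv_nff \<longleftrightarrow> u \<in> sv_Sx \<and> ff_defect u \<noteq> 0"
  using six_vertex_nonzero[of u]
  by (auto simp: sv_nff_def sv_Sx_def sv_S_def Delta_def Delta_ff_defect)

lemma Delta_nonzero:
  assumes "u \<in> sv_nff"
  shows "Delta u \<in> (UNIV - {0}) \<times> (UNIV - {0})"
  using assms six_vertex_nonzero[of u]
  by (auto simp: sv_nff_iff sv_Sx_def sv_S_def Delta_def Delta_ff_defect)

lemma Delta_scale:
  assumes "t \<noteq> 0"
  shows "Delta (op_scale t u) = Delta u"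
proof -
  have "ff_defect (op_scale t u) = t * t * ff_defect u"
    by (simp add: ff_defect_def algebra_simps)
  then show ?thesis
    using assms by (simp add: Delta_def Delta_ff_defect)
qed

text \<open>Inversion divides the corner product by \<open>(a\<^sub>1 a\<^sub>2)\<^sup>2\<close> and the block determinant \<open>D\<close> by \<open>D\<^sup>2\<close>, so
  the defect \<open>a\<^sub>1 a\<^sub>2 - D\<close> turns into \<open>1 / (a\<^sub>1 a\<^sub>2) - 1 / D\<close>, a nonzero multiple of itself.\<close>

lemma ff_defect_matrix_inv:
  assumes u: "u \<in> six_vertex" and D: "D = wt_c1 u * wt_c2 u - wt_b1 u * wt_b2 u"
  shows "ff_defect (matrix_inv u) = - ff_defect u / (wt_a1 u * wt_a2 u * D)"
proof -
  note nz = six_vertex_nonzero[OF u, folded D]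
  have "ff_defect (matrix_inv u) =
      1 / (wt_a1 u * wt_a2 u) - (wt_c1 u * wt_c2 u - wt_b1 u * wt_b2 u) / (D * D)"
    by (simp add: ff_defect_def matrix_inv_six_vertex(1)[OF u D] diff_divide_distrib mult_ac)
  also have "\<dots> = 1 / (wt_a1 u * wt_a2 u) - 1 / D"
    using nz by (simp flip: D)
  also have "\<dots> = - (wt_a1 u * wt_a2 u - D) / (wt_a1 u * wt_a2 u * D)"
    using nz by (simp add: field_simps)
  also have "wt_a1 u * wt_a2 u - D = ff_defect u"
    by (simp add: D ff_defect_def)
  finally show ?thesis .
qed

lemma Delta_matrix_inv:
  assumes "u \<in> sv_Sx"
  shows "Delta1 (matrix_inv u) = ff_defect u / (2 * wt_a2 u * wt_b1 u)"
    and "Delta2 (matrix_inv u) = ff_defect u / (2 * wt_a1 u * wt_b2 u)"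
proof -
  define D where "D = wt_c1 u * wt_c2 u - wt_b1 u * wt_b2 u"
  have u: "u \<in> six_vertex" and b: "wt_b1 u \<noteq> 0" "wt_b2 u \<noteq> 0"
    using assms by (auto simp: sv_Sx_def sv_S_def)
  note nz = six_vertex_nonzero[OF u, folded D_def] b
  show "Delta1 (matrix_inv u) = ff_defect u / (2 * wt_a2 u * wt_b1 u)"
    unfolding Delta_ff_defect ff_defect_matrix_inv[OF u D_def]
    using nz by (simp add: matrix_inv_six_vertex(1)[OF u D_def] field_simps)
  show "Delta2 (matrix_inv u) = ff_defect u / (2 * wt_a1 u * wt_b2 u)"
    unfolding Delta_ff_defect ff_defect_matrix_inv[OF u D_def]
    using nz by (simp add: matrix_inv_six_vertex(1)[OF u D_def] field_simps)
qed

lemma matrix_inv_sv_nff: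
  assumes "u \<in> sv_nff"
  shows "matrix_inv u \<in> sv_nff"
proof -
  define D where "D = wt_c1 u * wt_c2 u - wt_b1 u * wt_b2 u"
  have u: "u \<in> six_vertex"
    and nz: "wt_b1 u \<noteq> 0" "wt_b2 u \<noteq> 0" "wt_c1 u \<noteq> 0" "wt_c2 u \<noteq> 0" "ff_defect u \<noteq> 0"
    using assms by (auto simp: sv_nff_iff sv_Sx_def sv_S_def)
  note nz' = six_vertex_nonzero[OF u, folded D_def]
  have "wt_c2 u / D * (wt_c1 u / D) - - wt_b1 u / D * (- wt_b2 u / D) = D / (D * D)"
    by (simp add: D_def diff_divide_distrib mult.commute)
  then have "matrix_inv u \<in> six_vertex"
    unfolding matrix_inv_six_vertex(1)[OF u D_def]
    by (intro sv_mat_in_six_vertex) (use nz' in simp_all)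
  moreover have "ff_defect (matrix_inv u) \<noteq> 0"
    using nz nz' by (simp add: ff_defect_matrix_inv[OF u D_def])
  ultimately show ?thesis
    using nz nz' by (simp add: sv_nff_iff sv_Sx_def sv_S_def matrix_inv_six_vertex(1)[OF u D_def])
qed

section \<open>The Yang--Baxter bracket\<close>

lemma op_left_one: "op_left (mat 1) = mat 1"
  by (auto simp: vec_eq_iff op_left_def mat_def)

lemma op_right_one: "op_right (mat 1) = mat 1"
  by (auto simp: vec_eq_iff op_right_def mat_def)

lemma op_left_mult: "op_left (u ** v) = op_left u ** op_left v"
  by (simp add: vec_eq_iff forall_2 op_left_def mat_def matrix_matrix_mult_def sum_UNIV_prod sum_2)

lemma op_right_mult: "op_right (u ** v) = op_right u ** op_right v"
  by (simp add: vec_eq_iff forall_2 op_right_def mat_def matrix_matrix_mult_def sum_UNIV_prod sum_2)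

lemma yb_bracket_one_left: "yb_bracket (mat 1) v v = 0"
  by (simp add: yb_bracket_def op_left_one op_right_one)

lemma yb_bracket_one_right: "yb_bracket u u (mat 1) = 0"
  by (simp add: yb_bracket_def op_left_one op_right_one)

lemma yb_bracket_inverse:
  assumes "u ** v = mat 1" "v ** u = mat 1"
  shows "yb_bracket u (mat 1) v = 0"
  using assms
  by (simp add: yb_bracket_def op_left_one op_right_one flip: op_left_mult op_right_mult)

lemma op_left_scale: "op_left (op_scale t u) = map_matrix ((*) t) (op_left u)"
  by (simp add: vec_eq_iff op_left_def op_scale_def split: prod.split)

lemma op_right_scale: "op_right (op_scale t u) = map_matrix ((*) t) (op_right u)"
  by (simp add: vec_eq_iff op_right_def op_scale_def split: prod.split)

lemma map_matrix_times_mult: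
  fixes t :: "'a::comm_semiring_1"
  shows "map_matrix ((*) t) A ** B = map_matrix ((*) t) (A ** B)"
    and "A ** map_matrix ((*) t) B = map_matrix ((*) t) (A ** B)"
  by (simp_all add: vec_eq_iff matrix_matrix_mult_def sum_distrib_left mult_ac)

lemma yb_bracket_scale:
  "yb_bracket (op_scale r u) (op_scale s w) (op_scale t v) =
   map_matrix ((*) (r * s * t)) (yb_bracket u w v)"
  unfolding yb_bracket_def op_left_scale op_right_scale map_matrix_times_mult
  by (simp add: vec_eq_iff algebra_simps)

lemma yb_bracket_scale_eq_0:
  assumes "yb_bracket u w v = 0"
  shows "yb_bracket (op_scale r u) (op_scale s w) (op_scale t v) = 0"
  by (simp add: yb_bracket_scale assms vec_eq_iff)

lemma yb_bracket_unscale_eq_0: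
  assumes "yb_bracket (op_scale r u) w (op_scale t v) = 0" "r \<noteq> 0" "t \<noteq> 0"
  shows "yb_bracket u w v = 0"
  using yb_bracket_scale_eq_0[OF assms(1), of "1 / r" 1 "1 / t"] assms(2,3) by simp

section \<open>Solving the Yang--Baxter equation for the middle factor\<close>

text \<open>The bracket preserves the number of tensor factors equal to \<open>e\<^sub>2\<close>. The entries used here lie in
  the sectors with one and with two such factors; exchanging \<open>e\<^sub>1\<close> and \<open>e\<^sub>2\<close> exchanges these sectors
  and the subscripts of all weights, which pairs the first two equations and the two after them.\<close>

lemma yb_bracket_entries:
  assumes u: "u \<in> six_vertex" and v: "v \<in> six_vertex" and w: "w \<in> six_vertex"
    and "yb_bracket u w v = 0"
  shows "wt_c2 u * wt_a1 w * wt_c2 v + wt_b2 u * wt_c2 w * wt_b1 v = wt_a1 u * wt_c2 w * wt_a1 v"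
    and "wt_c1 u * wt_a2 w * wt_c1 v + wt_b1 u * wt_c1 w * wt_b2 v = wt_a2 u * wt_c1 w * wt_a2 v"
    and "wt_b1 u * wt_a1 w * wt_c2 v + wt_c1 u * wt_c2 w * wt_b1 v = wt_c2 v * wt_b1 w * wt_a1 u"
    and "wt_b2 u * wt_a2 w * wt_c1 v + wt_c2 u * wt_c1 w * wt_b2 v = wt_c1 v * wt_b2 w * wt_a2 u"
    and "wt_c1 u * wt_c2 w * wt_c1 v = wt_c2 u * wt_c1 w * wt_c2 v"
proof -
  obtain a1 a2 b1 b2 c1 c2 where U: "u = sv_mat a1 a2 b1 b2 c1 c2"
    using six_vertex_eq_sv_mat[OF u] by blast
  obtain a1' a2' b1' b2' c1' c2' where V: "v = sv_mat a1' a2' b1' b2' c1' c2'"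
    using six_vertex_eq_sv_mat[OF v] by blast
  obtain a1'' a2'' b1'' b2'' c1'' c2'' where W: "w = sv_mat a1'' a2'' b1'' b2'' c1'' c2''"
    using six_vertex_eq_sv_mat[OF w] by blast
  have z: "yb_bracket u w v $ p $ q = 0" for p q
    by (simp add: assms)
  note d = U V W yb_bracket_def op_left_def op_right_def matrix_matrix_mult_def
    sum_UNIV_prod sum_2 sv_mat_def[abs_def] mat_def
  show "wt_c2 u * wt_a1 w * wt_c2 v + wt_b2 u * wt_c2 w * wt_b1 v = wt_a1 u * wt_c2 w * wt_a1 v"
    using z[of "(2, 1, 1)" "(2, 1, 1)"] by (simp add: U V W) (simp add: d algebra_simps)
  show "wt_c1 u * wt_a2 w * wt_c1 v + wt_b1 u * wt_c1 w * wt_b2 v = wt_a2 u * wt_c1 w * wt_a2 v"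
    using z[of "(1, 2, 2)" "(1, 2, 2)"] by (simp add: U V W) (simp add: d algebra_simps)
  show "wt_b1 u * wt_a1 w * wt_c2 v + wt_c1 u * wt_c2 w * wt_b1 v = wt_c2 v * wt_b1 w * wt_a1 u"
    using z[of "(1, 2, 1)" "(2, 1, 1)"] by (simp add: U V W) (simp add: d algebra_simps)
  show "wt_b2 u * wt_a2 w * wt_c1 v + wt_c2 u * wt_c1 w * wt_b2 v = wt_c1 v * wt_b2 w * wt_a2 u"
    using z[of "(2, 1, 2)" "(1, 2, 2)"] by (simp add: U V W) (simp add: d algebra_simps)
  show "wt_c1 u * wt_c2 w * wt_c1 v = wt_c2 u * wt_c1 w * wt_c2 v"
    using z[of "(1, 2, 1)" "(1, 2, 1)"] by (simp add: U V W) (simp add: d algebra_simps)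
qed

text \<open>The only candidate, up to a scalar, for the Yang--Baxter composition of \<open>u\<close> and \<open>v\<close>, normalised
  by \<open>c\<^sub>2(w) = c\<^sub>2(u) c\<^sub>2(v)\<close>. It is obtained by eliminating \<open>c\<^sub>1\<close>, then \<open>a\<^sub>1, a\<^sub>2\<close>, then \<open>b\<^sub>1, b\<^sub>2\<close>.\<close>

definition yb_solution :: "op2 \<Rightarrow> op2 \<Rightarrow> op2" where
  "yb_solution u v = sv_mat
     (wt_a1 u * wt_a1 v - wt_b2 u * wt_b1 v)
     (wt_a2 u * wt_a2 v - wt_b1 u * wt_b2 v)
     (wt_b1 u * wt_a1 v + wt_b1 v * (wt_c1 u * wt_c2 u - wt_b1 u * wt_b2 u) / wt_a1 u)
     (wt_b2 u * wt_a2 v + wt_b2 v * (wt_c1 u * wt_c2 u - wt_b1 u * wt_b2 u) / wt_a2 u)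
     (wt_c1 u * wt_c1 v) (wt_c2 u * wt_c2 v)"

lemma yb_bracket_eq_0_imp_solution:
  assumes "u \<in> sv_S" "v \<in> sv_S" "w \<in> sv_S" and bracket: "yb_bracket u w v = 0"
  obtains s where "s \<noteq> 0" "w = op_scale s (yb_solution u v)"
proof -
  have u: "u \<in> six_vertex" and v: "v \<in> six_vertex" and w: "w \<in> six_vertex"
    and c: "wt_c1 u \<noteq> 0" "wt_c2 u \<noteq> 0" "wt_c1 v \<noteq> 0" "wt_c2 v \<noteq> 0" "wt_c2 w \<noteq> 0"
    using assms by (auto simp: sv_S_def)
  note a = six_vertex_nonzero(1,2)[OF u]
  note eq = yb_bracket_entries[OF u v w bracket]
  define s where "s = wt_c2 w / (wt_c2 u * wt_c2 v)"
  have "s \<noteq> 0"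
    using c by (simp add: s_def)
  have c2: "wt_c2 w = s * (wt_c2 u * wt_c2 v)"
    using c by (simp add: s_def)
  have "(wt_c2 u * wt_c2 v) * wt_c1 w = (wt_c2 u * wt_c2 v) * (s * (wt_c1 u * wt_c1 v))"
    using eq(5) c2 by algebra
  then have c1: "wt_c1 w = s * (wt_c1 u * wt_c1 v)"
    using c by simp
  have "(wt_c2 u * wt_c2 v) * wt_a1 w
      = (wt_c2 u * wt_c2 v) * (s * (wt_a1 u * wt_a1 v - wt_b2 u * wt_b1 v))"
    using eq(1) c2 by algebra
  then have a1: "wt_a1 w = s * (wt_a1 u * wt_a1 v - wt_b2 u * wt_b1 v)"
    using c by simp
  have "(wt_c1 u * wt_c1 v) * wt_a2 w
      = (wt_c1 u * wt_c1 v) * (s * (wt_a2 u * wt_a2 v - wt_b1 u * wt_b2 v))"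
    using eq(2) c1 by algebra
  then have a2: "wt_a2 w = s * (wt_a2 u * wt_a2 v - wt_b1 u * wt_b2 v)"
    using c by simp
  have "wt_c2 v * (wt_a1 u * wt_b1 w) = wt_c2 v * (s * (wt_a1 u * (wt_b1 u * wt_a1 v)
      + wt_b1 v * (wt_c1 u * wt_c2 u - wt_b1 u * wt_b2 u)))"
    using eq(3) a1 c2 by algebra
  then have "wt_a1 u * wt_b1 w = s * (wt_a1 u * (wt_b1 u * wt_a1 v)
      + wt_b1 v * (wt_c1 u * wt_c2 u - wt_b1 u * wt_b2 u))"
    using c by simp
  then have b1: "wt_b1 w = s * (wt_b1 u * wt_a1 v
      + wt_b1 v * (wt_c1 u * wt_c2 u - wt_b1 u * wt_b2 u) / wt_a1 u)"
    using a by (simp add: field_simps)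
  have "wt_c1 v * (wt_a2 u * wt_b2 w) = wt_c1 v * (s * (wt_a2 u * (wt_b2 u * wt_a2 v)
      + wt_b2 v * (wt_c1 u * wt_c2 u - wt_b1 u * wt_b2 u)))"
    using eq(4) a2 c1 by algebra
  then have "wt_a2 u * wt_b2 w = s * (wt_a2 u * (wt_b2 u * wt_a2 v)
      + wt_b2 v * (wt_c1 u * wt_c2 u - wt_b1 u * wt_b2 u))"
    using c by simp
  then have b2: "wt_b2 w = s * (wt_b2 u * wt_a2 v
      + wt_b2 v * (wt_c1 u * wt_c2 u - wt_b1 u * wt_b2 u) / wt_a2 u)"
    using a by (simp add: field_simps)
  have "w = op_scale s (yb_solution u v)"
    by (subst six_vertex_eq_sv_mat[OF w])
      (simp only: yb_solution_def op_scale_sv_mat a1 a2 b1 b2 c1 c2)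
  with \<open>s \<noteq> 0\<close> show ?thesis
    by (rule that)
qed

lemma yb_solution_unique:
  assumes "u \<in> sv_S" "v \<in> sv_S" "w \<in> sv_S" "w' \<in> sv_S"
    and "yb_bracket u w v = 0" "yb_bracket u w' v = 0"
  obtains t where "t \<noteq> 0" "w' = op_scale t w"
proof -
  obtain s where s: "s \<noteq> 0" "w = op_scale s (yb_solution u v)"
    using yb_bracket_eq_0_imp_solution assms(1,2,3,5) by blast
  obtain s' where s': "s' \<noteq> 0" "w' = op_scale s' (yb_solution u v)"
    using yb_bracket_eq_0_imp_solution assms(1,2,4,6) by blast
  show ?thesis
    by (rule that[of "s' / s"]) (use s s' in simp_all)
qed

section \<open>Compositions of non-free-fermionic matrices\<close>

text \<open>With \<open>N\<close> the free-fermion defect, the hypothesis says \<open>N(u) a\<^sub>2(v) b\<^sub>1(v) = N(v) a\<^sub>1(u) b\<^sub>1(u)\<close> and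
  \<open>N(u) a\<^sub>1(v) b\<^sub>2(v) = N(v) a\<^sub>2(u) b\<^sub>2(u)\<close>. Writing \<open>c\<^sub>1 c\<^sub>2\<close> as \<open>a\<^sub>1 a\<^sub>2 + b\<^sub>1 b\<^sub>2 - N\<close> for both \<open>u\<close> and \<open>v\<close>
  makes the assertion for the explicit solution an identity modulo these two relations.\<close>

lemma Delta1_yb_comp:
  assumes u: "u \<in> sv_Sx" and v: "v \<in> sv_Sx" and comp: "is_yb_comp u v w"
    and Delta: "Delta u = Delta (matrix_inv v)"
  shows "Delta1 w = Delta1 v"
proof -
  define Nu Nv where "Nu = ff_defect u" and "Nv = ff_defect v"
  have S: "u \<in> sv_S" "v \<in> sv_S" "w \<in> sv_S" "yb_bracket u w v = 0"
    and six: "u \<in> six_vertex" "v \<in> six_vertex" "w \<in> six_vertex"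
    and b: "wt_b1 u \<noteq> 0" "wt_b2 u \<noteq> 0" "wt_b1 v \<noteq> 0" "wt_b2 v \<noteq> 0" "wt_b1 w \<noteq> 0"
    using u v comp by (auto simp: is_yb_comp_def sv_Sx_def sv_S_def)
  note a = six_vertex_nonzero(1,2)[OF six(1)] six_vertex_nonzero(1,2)[OF six(2)]
    six_vertex_nonzero(1)[OF six(3)]
  have H1: "Nu * wt_a2 v * wt_b1 v = Nv * wt_a1 u * wt_b1 u"
    and H2: "Nu * wt_a1 v * wt_b2 v = Nv * wt_a2 u * wt_b2 u"
    using Delta a b unfolding Delta_def Delta_matrix_inv[OF v] Delta_ff_defect[of u] Nu_def Nv_def
    by (simp_all add: field_simps)
  have Nu: "wt_c1 u * wt_c2 u = wt_a1 u * wt_a2 u + wt_b1 u * wt_b2 u - Nu"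
    and Nv: "wt_c1 v * wt_c2 v = wt_a1 v * wt_a2 v + wt_b1 v * wt_b2 v - Nv"
    by (simp_all add: Nu_def Nv_def ff_defect_def)
  obtain s where s: "w = op_scale s (yb_solution u v)"
    using yb_bracket_eq_0_imp_solution[OF S] by blast
  have a1: "wt_a1 w = s * (wt_a1 u * wt_a1 v - wt_b2 u * wt_b1 v)"
    and a2: "wt_a2 w = s * (wt_a2 u * wt_a2 v - wt_b1 u * wt_b2 v)"
    by (simp_all add: s yb_solution_def)
  have b1: "wt_a1 u * wt_b1 w = s * (wt_b1 u * wt_a1 u * wt_a1 v
      + wt_b1 v * (wt_c1 u * wt_c2 u - wt_b1 u * wt_b2 u))"
    and b2: "wt_a2 u * wt_b2 w = s * (wt_b2 u * wt_a2 u * wt_a2 v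
      + wt_b2 v * (wt_c1 u * wt_c2 u - wt_b1 u * wt_b2 u))"
    using a by (simp_all add: s yb_solution_def field_simps)
  have cc: "wt_c1 w * wt_c2 w = s^2 * ((wt_a1 u * wt_a2 u + wt_b1 u * wt_b2 u - Nu)
      * (wt_a1 v * wt_a2 v + wt_b1 v * wt_b2 v - Nv))"
    unfolding Nu[symmetric] Nv[symmetric] by (simp add: s yb_solution_def power2_eq_square)
  \<comment> \<open>The relations trade the denominators \<open>a\<^sub>1(u)\<close> and \<open>a\<^sub>2(u)\<close> in \<open>b\<^sub>1(w)\<close> and \<open>b\<^sub>2(w)\<close> for \<open>a\<^sub>2(v)\<close> and
    \<open>a\<^sub>1(v)\<close>, so that \<open>b\<^sub>1(w) b\<^sub>2(w)\<close> gets the denominator \<open>a\<^sub>1(v) a\<^sub>2(v)\<close>.\<close>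
  have "wt_a1 u * (wt_a2 v * wt_b1 w) = wt_a2 v * (wt_a1 u * wt_b1 w)"
    by simp
  also have "\<dots> = wt_a1 u * (s * (wt_a2 u * wt_a2 v * wt_b1 v
      + wt_b1 u * (wt_a1 v * wt_a2 v - Nv)))"
    using H1 unfolding b1 Nu by algebra
  finally have b1': "wt_a2 v * wt_b1 w = s * (wt_a2 u * wt_a2 v * wt_b1 v
      + wt_b1 u * (wt_a1 v * wt_a2 v - Nv))"
    using a by simp
  have "wt_a2 u * (wt_a1 v * wt_b2 w) = wt_a1 v * (wt_a2 u * wt_b2 w)"
    by simp
  also have "\<dots> = wt_a2 u * (s * (wt_a1 u * wt_a1 v * wt_b2 v
      + wt_b2 u * (wt_a1 v * wt_a2 v - Nv)))"
    using H2 unfolding b2 Nu by algebra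
  finally have b2': "wt_a1 v * wt_b2 w = s * (wt_a1 u * wt_a1 v * wt_b2 v
      + wt_b2 u * (wt_a1 v * wt_a2 v - Nv))"
    using a by simp
  have "wt_a1 v * wt_a2 v * ((wt_a1 w * wt_a2 w + wt_b1 w * wt_b2 w - wt_c1 w * wt_c2 w)
        * (wt_a1 v * wt_b1 v))
      = wt_a1 v * wt_a2 v * (Nv * (wt_a1 w * wt_b1 w))"
    using b1' b2' cc H1 H2 a1 a2 by algebra
  then have "ff_defect w * (wt_a1 v * wt_b1 v) = Nv * (wt_a1 w * wt_b1 w)"
    using a by (simp add: ff_defect_def)
  then show ?thesis
    using a b by (simp add: Delta_ff_defect field_simps flip: Nv_def)
qed

lemma yb_comp_sv_nff:
  assumes "u \<in> sv_nff" "v \<in> sv_nff" "is_yb_comp u v w" "Delta u = Delta (matrix_inv v)"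
  shows "w \<in> sv_nff"
proof -
  have "Delta1 w \<noteq> 0"
    using Delta1_yb_comp[of u v w] Delta_nonzero[of v] assms
    by (auto simp: sv_nff_def Delta_def)
  then show ?thesis
    using assms(3) by (simp add: sv_nff_def is_yb_comp_def Delta_def)
qed

section \<open>The partial operation of the groupoid\<close>

lemma op_scale_in_scalar_class: "t \<noteq> 0 \<Longrightarrow> op_scale t u \<in> scalar_class u"
  by (auto simp: scalar_class_def)

lemma scalar_class_scale:
  assumes "t \<noteq> 0"
  shows "scalar_class (op_scale t u) = scalar_class u"
proof -
  have sub: "scalar_class (op_scale r x) \<subseteq> scalar_class x" if "r \<noteq> 0" for r x
  proof
    fix y assume "y \<in> scalar_class (op_scale r x)"
    then obtain s where "s \<noteq> 0" "y = op_scale (s * r) x"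
      by (auto simp: scalar_class_def)
    with that show "y \<in> scalar_class x"
      by (simp add: op_scale_in_scalar_class)
  qed
  have "scalar_class (op_scale (1 / t) (op_scale t u)) \<subseteq> scalar_class (op_scale t u)"
    by (rule sub) (use assms in simp)
  with sub[OF assms, of u] assms show ?thesis
    by simp
qed

lemma scalar_class_eqD:
  assumes "scalar_class u = scalar_class u'"
  obtains t where "t \<noteq> 0" "u' = op_scale t u"
proof -
  have "u' \<in> scalar_class u"
    using op_scale_in_scalar_class[of 1 u'] assms by simp
  then show ?thesis
    using that by (auto simp: scalar_class_def)
qed

lemma nff_elt_scale: "t \<noteq> 0 \<Longrightarrow> nff_elt (op_scale t u) = nff_elt u"
  by (simp add: nff_elt_def scalar_class_scale Delta_scale)

lemma nff_elt_eqD: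
  assumes "nff_elt u = nff_elt u'"
  obtains t where "t \<noteq> 0" "u' = op_scale t u"
  using assms scalar_class_eqD unfolding nff_elt_def by blast

lemma nff_elt_neq_nff_id:
  assumes "u \<in> sv_nff"
  shows "nff_elt u \<noteq> nff_id \<delta>"
proof
  assume "nff_elt u = nff_id \<delta>"
  then have "scalar_class (mat 1) = scalar_class u"
    by (simp add: nff_elt_def nff_id_def)
  then obtain t where "u = op_scale t (mat 1)"
    by (rule scalar_class_eqD)
  then have "wt_b1 u = 0"
    by (simp add: mat_one_eq_sv_mat)
  with assms show False
    by (simp add: sv_nff_def sv_Sx_def)
qed

lemma nff_id_inject: "nff_id \<delta> = nff_id \<delta>' \<longleftrightarrow> \<delta> = \<delta>'"
  by (simp add: nff_id_def)

lemma nff_elt_comp_unique: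
  assumes "u \<in> sv_nff" "v \<in> sv_nff" "is_yb_comp u v w" "is_yb_comp u' v' w'"
    and "nff_elt u = nff_elt u'" "nff_elt v = nff_elt v'"
  shows "nff_elt w = nff_elt w'"
proof -
  obtain r where r: "r \<noteq> 0" "u' = op_scale r u"
    using assms(5) by (rule nff_elt_eqD)
  obtain t where t: "t \<noteq> 0" "v' = op_scale t v"
    using assms(6) by (rule nff_elt_eqD)
  have "yb_bracket u w' v = 0"
    using assms(4) r t yb_bracket_unscale_eq_0 by (auto simp: is_yb_comp_def)
  then obtain s where "s \<noteq> 0" "w' = op_scale s w"
    using yb_solution_unique[of u v w w'] assms(1-4)
    by (auto simp: is_yb_comp_def sv_nff_def sv_Sx_def)
  then show ?thesis
    by (simp add: nff_elt_scale)
qed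

text \<open>The identity solves the equation for an inverse pair, so by uniqueness any solution in \<open>S\<close>
  is scalar and has \<open>b\<^sub>1 = 0\<close>.\<close>

lemma no_yb_comp_of_inverses:
  assumes "u \<in> sv_nff" "v \<in> sv_nff" "u' \<in> sv_nff"
    and "nff_elt u = nff_elt u'" "nff_elt v = nff_elt (matrix_inv u')"
  shows "\<not> is_yb_comp u v w"
proof
  assume w: "is_yb_comp u v w"
  obtain r where r: "r \<noteq> 0" "u' = op_scale r u"
    using assms(4) by (rule nff_elt_eqD)
  obtain t where t: "t \<noteq> 0" "matrix_inv u' = op_scale t v"
    using assms(5) by (rule nff_elt_eqD)
  have u': "u' \<in> six_vertex"
    using assms(3) by (simp add: sv_nff_def sv_Sx_def sv_S_def)
  have "yb_bracket u' (mat 1) (matrix_inv u') = 0"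
    by (intro yb_bracket_inverse matrix_inv_six_vertex(2,3)[OF u' refl])
  then have "yb_bracket u (mat 1) v = 0"
    unfolding t(2) unfolding r(2) by (rule yb_bracket_unscale_eq_0) (use r t in simp_all)
  moreover have "mat 1 \<in> sv_S"
    using sv_mat_in_six_vertex[of 1 1 1 1 0 0] by (simp add: sv_S_def mat_one_eq_sv_mat)
  ultimately obtain s where "w = op_scale s (mat 1)"
    using yb_solution_unique[of u v "mat 1" w] assms(1,2) w
    by (auto simp: is_yb_comp_def sv_nff_def sv_Sx_def)
  then have "wt_b1 w = 0"
    by (simp add: mat_one_eq_sv_mat)
  with w show False
    by (simp add: is_yb_comp_def sv_Sx_def)
qed

lemma nff_prod_right_unique:
  assumes "nff_prod g h k" "nff_prod g h k'"
  shows "k = k'"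
proof -
  note neq = nff_elt_neq_nff_id nff_elt_neq_nff_id[symmetric]
  from assms(1) show ?thesis
  proof cases
    case (comp u v w)
    from assms(2) show ?thesis
    proof cases
      case c': (comp u' v' w')
      have "nff_elt w = nff_elt w'"
        by (rule nff_elt_comp_unique[of u v w u' v' w']) (use comp c' in simp_all)
      with comp c' show ?thesis
        by simp
    next
      case (inv u')
      have "\<not> is_yb_comp u v w"
        by (rule no_yb_comp_of_inverses[of u v u']) (use comp inv in simp_all)
      with comp show ?thesis
        by simp
    qed (use comp in \<open>auto simp: neq\<close>)
  next
    case (inv u)
    from assms(2) show ?thesis
    proof cases
      case (comp u' v' w')
      have "\<not> is_yb_comp u' v' w'"
        by (rule no_yb_comp_of_inverses[of u' v' u]) (use comp inv in simp_all)
      with comp show ?thesis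
        by simp
    next
      case (inv u')
      \<comment> \<open>both candidates are the identity at the second component of \<open>h\<close>\<close>
      with \<open>h = nff_elt (matrix_inv u)\<close> \<open>k = nff_id (Delta (matrix_inv u))\<close> show ?thesis
        by (simp add: nff_elt_def)
    qed (use inv matrix_inv_sv_nff in \<open>auto simp: neq\<close>)
  next
    case (id_left v)
    from assms(2) show ?thesis
      by cases (use id_left in \<open>auto simp: neq nff_id_inject\<close>)
  next
    case (id_right u)
    from assms(2) show ?thesis
      by cases (use id_right matrix_inv_sv_nff in \<open>auto simp: neq nff_id_inject\<close>)
  next
    case (id_id \<delta>)
    from assms(2) show ?thesis
      by cases (use id_id in \<open>auto simp: neq nff_id_inject\<close>)
  qed
qed

lemma nff_mult_eq: "nff_prod g h k \<Longrightarrow> nff_mult g h = k"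
  unfolding nff_mult_def using nff_prod_right_unique by blast

section \<open>The bracket vanishes on products\<close>

lemma nff_proj_elt:
  assumes "is_nff_proj \<pi>" "u \<in> sv_nff"
  obtains t where "\<pi> (nff_elt u) = op_scale t u"
proof -
  have "\<pi> (nff_elt u) \<in> fst (nff_elt u)"
    using assms by (auto simp: is_nff_proj_def)
  then show ?thesis
    using that by (auto simp: nff_elt_def scalar_class_def)
qed

lemma nff_proj_id:
  assumes "is_nff_proj \<pi>" "u \<in> sv_nff"
  shows "\<pi> (nff_id (Delta u)) = mat 1"
  using conjunct2[OF assms(1)[unfolded is_nff_proj_def]] Delta_nonzero[OF assms(2)] by (rule bspec)

theorem theorem4p7:
  fixes \<pi> :: "gpd \<Rightarrow> op2" and g h :: gpd
  assumes "is_nff_proj \<pi>"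
    and "g \<in> G_nff" and "h \<in> G_nff"
    and "nff_defined g h"
  shows "yb_bracket (\<pi> g) (\<pi> (nff_mult g h)) (\<pi> h) = 0"
proof -
  obtain k where k: "nff_prod g h k"
    using assms(4) by (auto simp: nff_defined_def)
  from k have "yb_bracket (\<pi> g) (\<pi> k) (\<pi> h) = 0"
  proof cases
    case (comp u v w)
    have "w \<in> sv_nff"
      using yb_comp_sv_nff comp by blast
    then obtain r s t where "\<pi> g = op_scale r u" "\<pi> k = op_scale s w" "\<pi> h = op_scale t v"
      using comp nff_proj_elt[OF assms(1)] by metis
    then show ?thesis
      using comp by (simp add: yb_bracket_scale_eq_0 is_yb_comp_def)
  next
    case (inv u)
    have u: "u \<in> six_vertex"
      using inv by (simp add: sv_nff_def sv_Sx_def sv_S_def)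
    have "\<pi> k = mat 1"
      using inv nff_proj_id[OF assms(1)] matrix_inv_sv_nff by simp
    moreover obtain r t where "\<pi> g = op_scale r u" "\<pi> h = op_scale t (matrix_inv u)"
      using inv nff_proj_elt[OF assms(1)] matrix_inv_sv_nff by metis
    moreover have "yb_bracket u (mat 1) (matrix_inv u) = 0"
      by (intro yb_bracket_inverse matrix_inv_six_vertex(2,3)[OF u refl])
    ultimately show ?thesis
      using yb_bracket_scale_eq_0[of u "mat 1" "matrix_inv u" r 1 t] by simp
  next
    case (id_left v)
    then show ?thesis
      using nff_proj_id[OF assms(1)] matrix_inv_sv_nff by (simp add: yb_bracket_one_left)
  next
    case (id_right u)
    then show ?thesis
      using nff_proj_id[OF assms(1)] by (simp add: yb_bracket_one_right)
  next
    case (id_id \<delta>)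
    then have "\<pi> (nff_id \<delta>) = mat 1"
      using assms(1) unfolding is_nff_proj_def by blast
    with id_id show ?thesis
      by (simp add: yb_bracket_one_right)
  qed
  with nff_mult_eq[OF k] show ?thesis
    by simp
qed

end
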